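(* Let $\lambda \in \mathbb{C}$, $\lambda \neq 0,1$, let $m \geq 0$ be an integer, and let $K\subset\mathbb{C}$ be compact. Let the pair $(I_m, D_m)$, consisting of a finite set $I_m\subset\mathbb{Z}$ and a number $D_m>0$, be one of the following admissible choices, where $Z_m = \{k\in\mathbb{Z} : |k|\le m\}$, $Z_m^{+} = Z_m\cup\{m+1\}$, $Z_m^{-} = Z_m\cup\{-(m+1)\}$, $D^{-} = \left|1 - \frac{2\pi i(m+1)}{\log\lambda}\right|$ and $D^{+} = \left|1 + \frac{2\pi i(m+1)}{\log\lambda}\right|$: - if $\operatorname{Im}\lambda>0$: $(Z_m, D^{-})$ or $(Z_m^{+}, D^{+})$; - if $\operatorname{Im}\lambda<0$: $(Z_m, D^{+})$ or $(Z_m^{-}, D^{-})$; - if $\lambda>0$: $(Z_m, D^{-})$ (here $D^-=D^+$); - if $\lambda<0$: $(Z_m^{+}, D^{+})$. Then for all integers $n\ge 2$ and $z\in K$, $$(-1)^{n-1} \frac{(\log \lambda)^{n}}{n!} \lambda^{z} \mathcal{B}_{n}(z;\lambda) = \sum_{k \in I_{m}} \frac{e^{2\pi i k z}}{\bigl(1- \frac{2\pi i k}{\log\lambda}\bigr)^{n}} + O\left( \frac{e^{(2|\log\lambda|+2\pi(m+1))|z|}}{D_m^{\,n}} \right),$$ where the constant implicit in the order term depends only on $\lambda$, $m$ (and the choice of $I_m$) and $K$. Moreover, for $n$ sufficiently large (depending on $K$), it can be taken equal to the constant for the case $z=0$, thus making it independent of $K$: if $c$ is a constant for which the estimate holds at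 $z=0$ for all $n\ge 2$, then the estimate holds with the constant $c$ for all $z\in K$ and all $n\ge N$, for some $N$ depending on $K$.
   Context: The Apostol-Bernoulli polynomials $\mathcal{B}_n(x;\lambda)$ ($n\ge 0$, $\lambda\in\mathbb{C}$) are defined by the power series expansion at $z=0$ $$\frac{z e^{xz}}{\lambda e^z-1} = \sum_{n=0}^\infty \mathcal{B}_n(x;\lambda)\, \frac{z^n}{n!}.$$ $\log$ denotes the principal branch, $\log\lambda = \log|\lambda| + i\arg\lambda$ with $-\pi<\arg\lambda\le\pi$, and $\lambda^z = e^{z\log\lambda}$. The notation $\lambda>0$ or $\lambda<0$ means that $\lambda$ is real and positive or negative. *)

theory Defs
  imports "HOL-Complex_Analysis.Complex_Analysis"
begin

(* Division of formal power series cancels common powers of the indeterminate, so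
   this also covers lam = 1, where the denominator vanishes at 0. *)
definition apostol_bernoulli :: "nat \<Rightarrow> complex \<Rightarrow> complex \<Rightarrow> complex" where
  "apostol_bernoulli n x lam =
     fact n * fps_nth (fps_X * fps_exp x / (fps_const lam * fps_exp 1 - 1)) n"

lemma apostol_bernoulli_sums:
  "\<forall>\<^sub>F z in at 0. (\<lambda>n. apostol_bernoulli n x lam * z ^ n / fact n) sums
      (z * exp (x * z) / (lam * exp z - 1))"
proof -
  define F where "F = fps_X * fps_exp x"
  define G where "G = fps_const lam * fps_exp 1 - 1"
  define f where "f = (\<lambda>z::complex. z * exp (x * z))"
  define g where "g = (\<lambda>z::complex. lam * exp z - 1)"
  define h where "h = (\<lambda>z. if z = 0 then fps_nth F (subdegree G) / fps_nth G (subdegree G) else f z / g z)"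
  have f: "f has_fps_expansion F" and g: "g has_fps_expansion G"
    unfolding f_def g_def F_def G_def by (intro fps_expansion_intros)+
  have G1: "fps_nth G 1 = lam" and G0: "fps_nth G 0 = lam - 1"
    by (simp_all add: G_def)
  have "G \<noteq> 0"
    using G0 G1 by force
  have "subdegree G \<le> subdegree F"
  proof (cases "lam = 1")
    case True
    have "subdegree G \<le> 1"
      by (rule subdegree_leI) (use G1 True in auto)
    moreover have "1 \<le> subdegree F"
      by (rule subdegree_geI) (auto simp: F_def)
    ultimately show ?thesis by linarith
  next
    case False
    have "subdegree G \<le> 0"
      by (rule subdegree_leI) (use G0 False in auto)
    thus ?thesis by simp
  qed
  hence "h has_fps_expansion F / G"
    unfolding h_def by (intro has_fps_expansion_divide f g \<open>G \<noteq> 0\<close>) auto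
  hence "\<forall>\<^sub>F z in nhds 0. eval_fps (F / G) z = h z" and R: "fps_conv_radius (F / G) > 0"
    by (auto simp: has_fps_expansion_def)
  hence ev: "\<forall>\<^sub>F z in at 0. eval_fps (F / G) z = h z"
    by (simp add: eventually_nhds_conv_at)
  have "\<forall>\<^sub>F z in nhds 0. z \<in> eball 0 (fps_conv_radius (F / G))"
    by (intro eventually_nhds_in_open) (use R in \<open>auto simp: zero_ereal_def\<close>)
  hence "\<forall>\<^sub>F z in at 0. z \<in> eball 0 (fps_conv_radius (F / G))"
    by (rule filter_leD[rotated]) (simp add: at_within_le_nhds)
  with ev eventually_neq_at_within[of "0 :: complex" 0 UNIV] show ?thesis
  proof eventually_elim
    case (elim z)
    have "(\<lambda>n. fps_nth (F / G) n * z ^ n) sums eval_fps (F / G) z"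
      by (rule sums_eval_fps) (use elim in \<open>auto simp: in_eball_iff\<close>)
    thus ?case
      using elim by (simp add: h_def f_def g_def apostol_bernoulli_def F_def G_def)
  qed
qed

definition window :: "nat \<Rightarrow> int set" where
  "window m = {k. \<bar>k\<bar> \<le> int m}"

definition window_plus :: "nat \<Rightarrow> int set" where
  "window_plus m = window m \<union> {int m + 1}"

definition window_minus :: "nat \<Rightarrow> int set" where
  "window_minus m = window m \<union> {- (int m + 1)}"

definition dist_minus :: "complex \<Rightarrow> nat \<Rightarrow> real" where
  "dist_minus lam m = norm (1 - 2 * of_real pi * \<i> * (of_nat m + 1) / Ln lam)"

definition dist_plus :: "complex \<Rightarrow> nat \<Rightarrow> real" where
  "dist_plus lam m = norm (1 + 2 * of_real pi * \<i> * (of_nat m + 1) / Ln lam)"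

definition admissible :: "complex \<Rightarrow> nat \<Rightarrow> int set \<Rightarrow> real \<Rightarrow> bool" where
  "admissible lam m I D \<longleftrightarrow>
     (Im lam > 0 \<and> ((I, D) = (window m, dist_minus lam m) \<or> (I, D) = (window_plus m, dist_plus lam m))) \<or>
     (Im lam < 0 \<and> ((I, D) = (window m, dist_plus lam m) \<or> (I, D) = (window_minus m, dist_minus lam m))) \<or>
     (lam \<in> \<real> \<and> Re lam > 0 \<and> (I, D) = (window m, dist_minus lam m)) \<or>
     (lam \<in> \<real> \<and> Re lam < 0 \<and> (I, D) = (window_plus m, dist_plus lam m))"

lemma dist_minus_eq_dist_plus:
  assumes "lam \<in> \<real>" "Re lam > 0"
  shows   "dist_minus lam m = dist_plus lam m"
proof -
  obtain r where r: "lam = of_real r" "r > 0"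
    using assms by (auto elim!: Reals_cases)
  define w where "w = 1 - 2 * of_real pi * \<i> * (of_nat m + 1) / Ln lam"
  have "cnj w = 1 + 2 * of_real pi * \<i> * (of_nat m + 1) / Ln lam"
    using r by (simp add: w_def Ln_of_real)
  thus ?thesis
    unfolding dist_minus_def dist_plus_def w_def[symmetric] by (metis complex_mod_cnj)
qed

lemma finite_admissible:
  assumes "admissible lam m I D"
  shows   "finite I"
proof -
  have "window m = {- int m..int m}"
    by (auto simp: window_def)
  thus ?thesis
    using assms by (auto simp: admissible_def window_plus_def window_minus_def)
qed

lemma admissible_pos:
  assumes "lam \<noteq> 0" "admissible lam m I D"
  shows   "D > 0"
proof -
  have *: "1 + s * (2 * of_real pi * \<i> * (of_nat m + 1)) / Ln lam \<noteq> 0" if "s = 1 \<or> s = -1" for s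
  proof
    assume eq: "1 + s * (2 * of_real pi * \<i> * (of_nat m + 1)) / Ln lam = 0"
    hence "Ln lam \<noteq> 0" by auto
    with eq have "Ln lam = - s * (2 * of_real pi * \<i> * (of_nat m + 1))"
      by (simp add: field_simps eq_neg_iff_add_eq_0)
    hence "\<bar>Im (Ln lam)\<bar> = 2 * pi * (m + 1)"
      using that by (auto simp: abs_mult)
    moreover have "\<bar>Im (Ln lam)\<bar> \<le> pi"
      using mpi_less_Im_Ln[OF assms(1)] Im_Ln_le_pi[OF assms(1)] by linarith
    moreover have "pi * 1 < pi * (2 * (real m + 1))"
      by (intro mult_strict_left_mono) auto
    ultimately show False by (simp add: algebra_simps)
  qed
  from *[of 1] *[of "-1"] assms(2) show ?thesis
    by (auto simp: admissible_def dist_minus_def dist_plus_def)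
qed

definition remainder :: "complex \<Rightarrow> int set \<Rightarrow> nat \<Rightarrow> complex \<Rightarrow> complex" where
  "remainder lam I n z =
     (-1) ^ (n - 1) * (Ln lam ^ n / fact n) * lam powr z * apostol_bernoulli n z lam
     - (\<Sum>k\<in>I. exp (2 * of_real pi * \<i> * of_int k * z)
                 / (1 - 2 * of_real pi * \<i> * of_int k / Ln lam) ^ n)"

definition estimate ::
  "complex \<Rightarrow> nat \<Rightarrow> int set \<Rightarrow> real \<Rightarrow> real \<Rightarrow> nat \<Rightarrow> complex \<Rightarrow> bool" where
  "estimate lam m I D c n z \<longleftrightarrow>
     norm (remainder lam I n z)
       \<le> c * (exp ((2 * norm (Ln lam) + 2 * pi * (real m + 1)) * norm z) / D ^ n)"

end

theory Submission
  imports Defs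
begin

text \<open>
  With \<open>L = Ln lam\<close>, the function \<open>w * exp (z * w) / (lam * exp w - 1)\<close> is holomorphic at 0 and has
  its poles at the points \<open>2 \<pi> \<i> k - L\<close>. Applying the residue theorem to its quotient by
  \<open>w ^ (n + 1)\<close> on a circle around 0 shows that the normalised \<open>n\<close>-th coefficient equals the sum
  of \<open>exp (2 \<pi> \<i> k z) / (1 - 2 \<pi> \<i> k / L) ^ n\<close> over the enclosed poles, up to an error that decays
  with the \<open>n\<close>-th power of the radius (\<open>coefficient_pole_bound\<close>, \<open>remainder_bounds\<close>).

  Each admissible window is the set of all \<open>k\<close> whose pole is nearer to 0 than the pole of one
  particular index \<open>k0\<close> of absolute value \<open>m + 1\<close>, and \<open>D = norm (1 - 2 \<pi> \<i> k0 / L)\<close>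
  (\<open>admissible_nearest\<close>). Let \<open>J\<close> be the set of indices of the poles at the same distance as that
  of \<open>k0\<close>; it may have two elements. The remainder multiplied by \<open>D ^ n\<close> is then a sum over \<open>J\<close> of
  unimodular coefficients times \<open>exp (2 \<pi> \<i> k z)\<close>, plus a geometrically small error
  (\<open>nearest_excluded_poles\<close>). By the triangle inequality, every \<open>k\<close> in \<open>J\<close> satisfies
  \<open>2 \<pi> \<bar>k\<bar> \<le> A\<close> with \<open>A = 2 * norm L + 2 \<pi> (m + 1)\<close>, which is the exponential rate in the
  claim. This proves the estimate with some constant.

  For the constant from \<open>z = 0\<close>, compare the remainder at \<open>z\<close> with that at 0. The terms from
  \<open>J\<close> change by at most the sum of \<open>exp (2 \<pi> \<bar>k\<bar> * norm z) - 1\<close>, and since \<open>2 \<pi> \<bar>k0\<bar>\<close> lies below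
  \<open>A\<close> by \<open>2 * norm L > 0\<close>, this is at most \<open>card J * (exp (A * norm z) - 1) - 2 * norm L * norm z\<close>
  (\<open>growth_deficit\<close>). The rest changes by at most a null sequence times \<open>norm z\<close>, which the last
  term absorbs for large \<open>n\<close>. Any constant \<open>c\<close> valid at 0 satisfies \<open>card J \<le> c\<close>, because the
  unimodular coefficients, which are \<open>n\<close>-th powers, simultaneously return near 1 for
  arbitrarily large \<open>n\<close> (\<open>card_le_constant_at_zero\<close>). Hence the remainder at \<open>z\<close> is bounded by
  \<open>c + c * (exp (A * norm z) - 1)\<close>.
\<close>

section \<open>Elementary estimates for the exponential function\<close>

lemma norm_exp_minus_one_le:
  fixes u :: complex
  shows "norm (exp u - 1) \<le> exp (norm u) - 1"
proof -
  have "(\<lambda>n. u ^ n /\<^sub>R fact n) sums exp u"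
    by (rule exp_converges)
  hence s: "(\<lambda>n. u ^ Suc n /\<^sub>R fact (Suc n)) sums (exp u - 1)"
    by (subst sums_Suc_iff) simp
  have "(\<lambda>n. norm u ^ n /\<^sub>R fact n) sums exp (norm u)"
    by (rule exp_converges)
  hence s': "(\<lambda>n. norm u ^ Suc n /\<^sub>R fact (Suc n)) sums (exp (norm u) - 1)"
    by (subst sums_Suc_iff) simp
  have "norm (\<Sum>n. u ^ Suc n /\<^sub>R fact (Suc n)) \<le> (\<Sum>n. norm u ^ Suc n /\<^sub>R fact (Suc n))"
    by (rule norm_suminf_le) (use sums_summable[OF s'] in \<open>auto simp: norm_mult norm_power\<close>)
  thus ?thesis
    using s s' by (simp add: sums_iff)
qed

lemma exp_minus_one_le:
  fixes x :: real
  shows "exp x - 1 \<le> x * exp x"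
proof -
  have "1 - x \<le> exp (- x)"
    using exp_ge_add_one_self[of "-x"] by simp
  hence "(1 - x) * exp x \<le> exp (- x) * exp x"
    by (intro mult_right_mono) auto
  thus ?thesis by (simp add: algebra_simps flip: exp_add)
qed

section \<open>Simultaneous recurrence of powers on the unit circle\<close>

text \<open>
  Writing the points as \<open>exp (2 \<pi> \<i> \<theta>)\<close>, simultaneous Dirichlet approximation gives a positive
  \<open>q\<close> for which all \<open>q \<theta>\<close> are close to integers. Dirichlet gives no lower bound on \<open>q\<close>, so to
  reach beyond \<open>N\<close> the exponent is the multiple \<open>(N + 1) q\<close>, with the approximation made finer
  by the same factor.
\<close>
lemma unit_powers_recur:
  fixes v :: "'a \<Rightarrow> complex"
  assumes J: "finite J" and v: "\<And>k. k \<in> J \<Longrightarrow> norm (v k) = 1" and e: "e > 0"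
  shows "\<exists>n\<ge>N. \<forall>k\<in>J. norm (v k ^ n - 1) < e"
proof -
  have "isCont exp (0 :: complex)"
    by simp
  then obtain d where d: "d > 0" "\<And>u::complex. norm u < d \<Longrightarrow> norm (exp u - 1) < e"
    using e unfolding continuous_at_eps_delta by (auto simp: dist_norm)
  define M where "M = nat \<lceil>2 * pi * real (Suc N) / d\<rceil> + 1"
  have "M > 0" by (simp add: M_def)
  have M: "2 * pi * real (Suc N) / M < d"
  proof -
    have "2 * pi * real (Suc N) / d < real M"
      unfolding M_def by linarith
    thus ?thesis using d \<open>M > 0\<close> by (simp add: field_simps)
  qed
  obtain f where f: "bij_betw f {..<card J} J"
    using J ex_bij_betw_nat_finite atLeast0LessThan by metis
  define \<theta> where "\<theta> i = Arg (v (f i)) / (2 * pi)" for i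
  obtain q p where q: "0 < q" "\<And>i. i < card J \<Longrightarrow> \<bar>of_int q * \<theta> i - of_int (p i)\<bar> < 1 / M"
    using Dirichlet_approx_simult[OF \<open>M > 0\<close>, of "card J" \<theta>] by metis
  define n where "n = Suc N * nat q"
  have "n \<ge> N"
    using q(1) by (cases "nat q") (auto simp: n_def)
  moreover have "norm (v k ^ n - 1) < e" if k: "k \<in> J" for k
  proof -
    obtain i where i: "i < card J" "k = f i"
      using f k by (auto simp: bij_betw_def)
    define x where "x = real (Suc N) * (of_int q * \<theta> i - of_int (p i))"
    have vk: "v k = exp (\<i> * of_real (2 * pi * \<theta> i))"
      using Arg_eq[of "v k"] v[OF k] i(2) by (cases "v k = 0") (auto simp: \<theta>_def)
    have "v k ^ n = exp (of_nat n * (\<i> * of_real (2 * pi * \<theta> i)))"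
      unfolding vk by (rule exp_of_nat_mult [symmetric])
    also have "of_nat n * (\<i> * of_real (2 * pi * \<theta> i)) =
        \<i> * of_real (2 * pi * x) + (of_int (2 * (int (Suc N) * p i)) * pi) * \<i>"
      using q(1) by (simp add: n_def x_def algebra_simps)
    also have "exp \<dots> = exp (\<i> * of_real (2 * pi * x))"
      by (subst exp_eq) blast
    finally have eq: "v k ^ n = exp (\<i> * of_real (2 * pi * x))" .
    have "\<bar>x\<bar> \<le> real (Suc N) * (1 / M)"
      unfolding x_def abs_mult using q(2)[OF i(1)] by (intro mult_mono) auto
    hence "2 * pi * \<bar>x\<bar> \<le> 2 * pi * (real (Suc N) * (1 / M))"
      by (intro mult_left_mono) auto
    also have "\<dots> < d"
      using M by simp
    finally have "norm (\<i> * complex_of_real (2 * pi * x)) < d"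
      by (simp add: norm_mult abs_mult)
    from d(2)[OF this] show ?thesis unfolding eq .
  qed
  ultimately show ?thesis by blast
qed

section \<open>The poles of the generating function\<close>

text \<open>
  For \<open>lam \<noteq> 0\<close>, these are the zeros of the denominator \<open>lam * exp w - 1\<close> of the generating function.
\<close>
definition pole :: "complex \<Rightarrow> int \<Rightarrow> complex" where
  "pole lam k = 2 * of_real pi * \<i> * of_int k - Ln lam"

lemma exp_pole:
  assumes "lam \<noteq> 0"
  shows   "lam * exp (pole lam k) = 1"
proof -
  have "exp (pole lam k) = exp (- Ln lam)"
    by (subst exp_eq) (auto simp: pole_def intro!: exI[of _ k])
  thus ?thesis
    using assms by (simp add: exp_minus)
qed

lemma denominator_zeros:
  assumes "lam \<noteq> 0"
  shows   "lam * exp w = 1 \<longleftrightarrow> w \<in> range (pole lam)"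
proof
  assume "lam * exp w = 1"
  hence "exp w = exp (- Ln lam)"
    using assms by (simp add: exp_minus field_simps)
  then obtain k :: int where "w = - Ln lam + (of_int (2 * k) * pi) * \<i>"
    by (subst (asm) exp_eq) blast
  hence "w = pole lam k" by (simp add: pole_def)
  thus "w \<in> range (pole lam)" by blast
qed (use exp_pole[OF assms] in auto)

lemma inj_pole: "inj (pole lam)"
  by (rule injI) (simp add: pole_def)

lemma pole_nonzero:
  assumes "lam \<noteq> 0" "lam \<noteq> 1"
  shows   "pole lam k \<noteq> 0"
  using exp_pole[OF assms(1), of k] assms(2) by auto

lemma Ln_nonzero:
  assumes "lam \<noteq> 0" "lam \<noteq> 1"
  shows   "Ln lam \<noteq> 0"
  using exp_Ln[OF assms(1)] assms(2) by auto

text \<open>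
  The bases of the powers in the expansion: the poles measured in units of the pole
  \<open>- Ln lam\<close> of index 0. The numbers \<open>dist_minus\<close> and \<open>dist_plus\<close> are the absolute values for the
  indices \<open>m + 1\<close> and \<open>- (m + 1)\<close>.
\<close>
definition ratio :: "complex \<Rightarrow> int \<Rightarrow> complex" where
  "ratio lam k = 1 - 2 * of_real pi * \<i> * of_int k / Ln lam"

lemma pole_eq_ratio:
  assumes "lam \<noteq> 0" "lam \<noteq> 1"
  shows   "pole lam k = - Ln lam * ratio lam k"
  using Ln_nonzero[OF assms] by (simp add: pole_def ratio_def field_simps)

lemma norm_frequency_le: "2 * pi * \<bar>real_of_int k\<bar> \<le> norm (pole lam k) + norm (Ln lam)"
proof -
  have "2 * pi * \<bar>real_of_int k\<bar> = norm (pole lam k + Ln lam)"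
    by (simp add: pole_def norm_mult)
  also have "\<dots> \<le> norm (pole lam k) + norm (Ln lam)" by (rule norm_triangle_ineq)
  finally show ?thesis .
qed

lemma norm_pole_le: "norm (pole lam k) \<le> 2 * pi * \<bar>real_of_int k\<bar> + norm (Ln lam)"
proof -
  have "norm (pole lam k) \<le> norm (2 * of_real pi * \<i> * of_int k) + norm (Ln lam)"
    unfolding pole_def by (rule norm_triangle_ineq4)
  thus ?thesis by (simp add: norm_mult)
qed

lemma finite_poles_cball: "finite {k. norm (pole lam k) \<le> r}"
proof (rule finite_subset)
  define N where "N = \<lceil>(r + norm (Ln lam)) / (2 * pi)\<rceil>"
  show "{k. norm (pole lam k) \<le> r} \<subseteq> {-N..N}"
  proof
    fix k assume "k \<in> {k. norm (pole lam k) \<le> r}"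
    with norm_frequency_le[of k lam] have "2 * pi * \<bar>real_of_int k\<bar> \<le> r + norm (Ln lam)"
      by auto
    hence "\<bar>real_of_int k\<bar> \<le> (r + norm (Ln lam)) / (2 * pi)"
      by (simp add: field_simps)
    hence "\<bar>k\<bar> \<le> N" unfolding N_def by linarith
    thus "k \<in> {-N..N}" by auto
  qed
qed auto

lemma pole_free_annulus: "\<exists>R>r. \<forall>k. norm (pole lam k) < R \<longrightarrow> norm (pole lam k) \<le> r"
proof -
  define T where "T = insert (r + 1) ((\<lambda>k. norm (pole lam k)) ` {k. norm (pole lam k) \<le> r + 1} \<inter> {r<..})"
  have T: "finite T" "T \<noteq> {}"
    using finite_poles_cball[of lam "r + 1"] by (auto simp: T_def)
  have "Min T > r"
    using T by (subst Min_gr_iff) (auto simp: T_def)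
  moreover have "norm (pole lam k) \<le> r" if "norm (pole lam k) < Min T" for k
  proof (rule ccontr)
    assume "\<not> norm (pole lam k) \<le> r"
    moreover have "Min T \<le> r + 1"
      using T by (intro Min_le) (auto simp: T_def)
    ultimately have "norm (pole lam k) \<in> T"
      using that by (auto simp: T_def)
    hence "Min T \<le> norm (pole lam k)"
      using T by (intro Min_le)
    with that show False by simp
  qed
  ultimately show ?thesis by blast
qed

section \<open>Coefficients of the generating function and its poles\<close>

text \<open>
  The function \<open>w * h w / (lam * exp w - 1) / w ^ (n + 1)\<close> has the coefficient as its residue at 0
  and \<open>h p / p ^ n\<close> as its residue at each pole \<open>p\<close>, because \<open>lam * exp w\<close> is its own derivative and
  equals 1 at \<open>p\<close>. Integration over the circle of radius \<open>rho\<close> gives the bound. An arbitrary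
  entire \<open>h\<close> lets the same bound be applied to the difference of the generating functions
  for \<open>z\<close> and for 0.
\<close>
lemma coefficient_pole_bound:
  fixes h :: "complex \<Rightarrow> complex"
  assumes lam: "lam \<noteq> 0" "lam \<noteq> 1"
    and h: "h holomorphic_on UNIV" "h has_fps_expansion H"
    and rho: "0 < rho" "rho < R"
    and S: "finite S" "\<And>k. k \<in> S \<Longrightarrow> norm (pole lam k) < rho"
      "\<And>k. norm (pole lam k) < R \<Longrightarrow> k \<in> S"
    and C: "C \<ge> 0" "\<And>w. norm w = rho \<Longrightarrow> norm (w * h w / (lam * exp w - 1)) \<le> C"
  shows "norm (fps_nth (fps_X * H / (fps_const lam * fps_exp 1 - 1)) n
           + (\<Sum>k\<in>S. h (pole lam k) / pole lam k ^ n)) \<le> C / rho ^ n"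
proof -
  define f where "f = (\<lambda>w. w * h w / (lam * exp w - 1))"
  have exp_f: "f has_fps_expansion fps_X * H / (fps_const lam * fps_exp 1 - 1)"
    unfolding f_def using h(2) lam
    by (intro has_fps_expansion_divide' fps_expansion_intros) auto
  have *: "norm ((deriv ^^ n) f 0 / fact n + (\<Sum>w\<in>pole lam ` S. residue (\<lambda>w. f w / w ^ Suc n) w))
          \<le> C / rho ^ n"
  proof (rule fps_coeff_residues_bound[where A = "ball 0 R" and k = "{}"])
    show "f holomorphic_on ball 0 R - pole lam ` S"
      unfolding f_def
    proof (intro holomorphic_intros holomorphic_on_subset[OF h(1)])
      fix w assume w: "w \<in> ball 0 R - pole lam ` S"
      hence "w \<notin> range (pole lam)" using S(3) by auto
      thus "lam * exp w - 1 \<noteq> 0"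
        using denominator_zeros[OF lam(1), of w] by auto
    qed auto
    show "0 \<notin> pole lam ` S"
      using pole_nonzero[OF lam] by auto
  qed (use rho S C in \<open>auto simp: f_def\<close>)
  have res: "residue (\<lambda>w. f w / w ^ Suc n) (pole lam k) = h (pole lam k) / pole lam k ^ n" for k
    \<comment> \<open>Distinct poles are at least \<open>2 \<pi>\<close> apart, so a unit ball around one contains no other.\<close>
  proof (rule residue_simple'[where s = "ball (pole lam k) 1 - {0}"])
    define p where "p = pole lam k"
    have p0: "p \<noteq> 0" and p1: "lam * exp p = 1"
      using pole_nonzero[OF lam] exp_pole[OF lam(1)] by (auto simp: p_def)
    show "open (ball (pole lam k) 1 - {0})"
      by (intro open_Diff) auto
    show "pole lam k \<in> ball (pole lam k) 1 - {0}"
      using p0 by (auto simp: p_def)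
    show "(\<lambda>w. f w / w ^ Suc n) holomorphic_on ball (pole lam k) 1 - {0} - {pole lam k}"
      unfolding f_def
    proof (intro holomorphic_intros holomorphic_on_subset[OF h(1)])
      fix w assume w: "w \<in> ball (pole lam k) 1 - {0} - {pole lam k}"
      show "lam * exp w - 1 \<noteq> 0"
      proof
        assume "lam * exp w - 1 = 0"
        then obtain j where j: "w = pole lam j"
          using denominator_zeros[OF lam(1), of w] by auto
        hence "pole lam k - w = 2 * of_real pi * \<i> * of_int (k - j)"
          by (simp add: pole_def algebra_simps)
        hence "dist (pole lam k) w = 2 * pi * \<bar>of_int (k - j)\<bar>"
          by (simp only: dist_norm norm_mult norm_of_int) simp
        moreover have kj: "1 \<le> \<bar>of_int (k - j) :: real\<bar>"
          using w j by (cases "k = j") (auto simp del: of_int_diff)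
        moreover have "2 * pi * 1 \<le> 2 * pi * \<bar>of_int (k - j) :: real\<bar>"
          using kj by (intro mult_left_mono) auto
        ultimately have "dist (pole lam k) w > 1"
          using pi_gt3 by linarith
        thus False
          using w by auto
      qed
    qed auto
    have "((\<lambda>w. lam * exp w - 1) has_field_derivative lam * exp p) (at p)"
      by (auto intro!: derivative_eq_intros)
    hence D: "((\<lambda>w. (lam * exp w - 1) / (w - p)) \<longlongrightarrow> 1) (at p)"
      using p1 by (simp add: has_field_derivative_iff)
    have "isCont h p"
      using h(1) by (meson UNIV_I continuous_on_eq_continuous_at holomorphic_on_imp_continuous_on open_UNIV)
    hence "((\<lambda>w. w * h w / w ^ Suc n / ((lam * exp w - 1) / (w - p)))
             \<longlongrightarrow> p * h p / p ^ Suc n / 1) (at p)"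
      using p0 by (intro tendsto_intros D) (auto simp: isCont_def)
    also have "(\<lambda>w. w * h w / w ^ Suc n / ((lam * exp w - 1) / (w - p))) =
        (\<lambda>w. f w / w ^ Suc n * (w - p))"
      by (simp add: f_def fun_eq_iff)
    also have "p * h p / p ^ Suc n / 1 = h p / p ^ n"
      using p0 by simp
    finally show "((\<lambda>w. f w / w ^ Suc n * (w - pole lam k)) \<longlongrightarrow>
        h (pole lam k) / pole lam k ^ n) (at (pole lam k))"
      unfolding p_def .
  qed
  have "(\<Sum>w\<in>pole lam ` S. residue (\<lambda>w. f w / w ^ Suc n) w)
      = (\<Sum>k\<in>S. h (pole lam k) / pole lam k ^ n)"
    by (subst sum.reindex) (use inj_pole in \<open>auto simp: inj_on_def res simp del: power_Suc\<close>)
  moreover have "(deriv ^^ n) f 0 / fact n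
      = fps_nth (fps_X * H / (fps_const lam * fps_exp 1 - 1)) n"
    using fps_nth_fps_expansion[OF exp_f, of n] by simp
  ultimately show ?thesis
    using * by simp
qed

text \<open>
  Since \<open>lam powr z = exp (z * Ln lam)\<close>, multiplying by it turns the residue
  \<open>exp (z * pole lam k) / pole lam k ^ n\<close> into the exponential with frequency \<open>k\<close>; the sign comes from
  \<open>pole lam k = - Ln lam * ratio lam k\<close>. The hypothesis on \<open>n\<close> excludes the truncated exponent
  \<open>n - 1\<close> at \<open>n = 0\<close>, where the sign would be wrong.
\<close>
lemma remainder_eq:
  assumes lam: "lam \<noteq> 0" "lam \<noteq> 1" and n: "n \<ge> 1"
  shows "remainder lam S n z = (-1) ^ (n - 1) * Ln lam ^ n *
     (fps_nth (fps_X * (fps_const (exp (z * Ln lam)) * fps_exp z) / (fps_const lam * fps_exp 1 - 1)) n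
       + (\<Sum>k\<in>S. exp (z * (pole lam k + Ln lam)) / pole lam k ^ n))"
proof -
  define G where "G = fps_const lam * fps_exp 1 - 1"
  have G0: "fps_nth G 0 \<noteq> 0"
    using lam by (simp add: G_def)
  have "fps_X * (fps_const (exp (z * Ln lam)) * fps_exp z) / G
      = fps_const (exp (z * Ln lam)) * (fps_X * fps_exp z / G)"
    by (simp add: fps_divide_unit[OF G0] mult_ac)
  hence 1: "fps_nth (fps_X * (fps_const (exp (z * Ln lam)) * fps_exp z) / G) n
      = exp (z * Ln lam) * fps_nth (fps_X * fps_exp z / G) n"
    by simp
  have 2: "(-1) ^ (n - 1) * Ln lam ^ n * (exp (z * (pole lam k + Ln lam)) / pole lam k ^ n)
      = - (exp (2 * of_real pi * \<i> * of_int k * z) / ratio lam k ^ n)" for k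
  proof -
    have "(-1) ^ n = - ((-1) ^ (n - 1) :: complex)"
      using n by (cases n) auto
    hence p: "pole lam k ^ n = - ((-1) ^ (n - 1) * Ln lam ^ n * ratio lam k ^ n)"
      unfolding pole_eq_ratio[OF lam] power_mult_distrib power_minus[of "Ln lam"] by simp
    have e: "z * (pole lam k + Ln lam) = 2 * of_real pi * \<i> * of_int k * z"
      by (simp add: pole_def)
    show ?thesis
      unfolding p e using Ln_nonzero[OF lam] by simp
  qed
  show ?thesis
    unfolding distrib_left[of "(-1) ^ (n - 1) * Ln lam ^ n"] sum_distrib_left 1[unfolded G_def] 2
    using lam by (simp add: remainder_def apostol_bernoulli_def powr_def sum_negf ratio_def)
qed

text \<open>
  Subtracting all poles in a closed disc leaves a generating function that is holomorphic in a
  slightly larger disc, which gains a geometric factor over the radius of the closed disc. The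
  second bound keeps a factor \<open>norm z\<close>, which is what makes it comparable with
  \<open>exp (A * norm z) - 1\<close> near \<open>z = 0\<close>. It comes from the numerator
  \<open>exp (z * (w + Ln lam)) - 1\<close>, which is of order \<open>norm z\<close> on the circle.
\<close>
lemma remainder_bounds:
  assumes lam: "lam \<noteq> 0" "lam \<noteq> 1" and r: "0 < r" and M: "0 \<le> M"
  shows "\<exists>rho>r. \<exists>B\<ge>0. \<forall>n\<ge>1.
     norm (remainder lam {k. norm (pole lam k) \<le> r} n 0) \<le> B * (norm (Ln lam) / rho) ^ n \<and>
     (\<forall>z. norm z \<le> M \<longrightarrow>
       norm (remainder lam {k. norm (pole lam k) \<le> r} n z - remainder lam {k. norm (pole lam k) \<le> r} n 0)
         \<le> B * norm z * (norm (Ln lam) / rho) ^ n)"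
proof -
  define S where "S = {k. norm (pole lam k) \<le> r}"
  define G where "G = fps_const lam * fps_exp 1 - 1"
  define L where "L = Ln lam"
  have G0: "fps_nth G 0 \<noteq> 0"
    using lam by (simp add: G_def)
  obtain R where R: "R > r" "\<And>k. norm (pole lam k) < R \<Longrightarrow> norm (pole lam k) \<le> r"
    using pole_free_annulus[of r lam] by metis
  obtain rho where rho: "r < rho" "rho < R"
    using dense R(1) by blast
  have S: "finite S" "\<And>k. k \<in> S \<Longrightarrow> norm (pole lam k) < rho"
      "\<And>k. norm (pole lam k) < R \<Longrightarrow> k \<in> S"
    using finite_poles_cball rho R(2) by (auto simp: S_def)
  have "compact ((\<lambda>w. w / (lam * exp w - 1)) ` sphere 0 rho)"
  proof (intro compact_continuous_image continuous_intros ballI)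
    fix w :: complex assume w: "w \<in> sphere 0 rho"
    have "w \<noteq> pole lam k" for k
      using w S(2)[of k] S(3)[of k] rho by auto
    thus "lam * exp w - 1 \<noteq> 0"
      using denominator_zeros[OF lam(1), of w] by auto
  qed auto
  then obtain Q where "\<forall>u\<in>(\<lambda>w. w / (lam * exp w - 1)) ` sphere 0 rho. norm u \<le> Q"
    using compact_imp_bounded bounded_iff by metis
  hence Q: "norm (w / (lam * exp w - 1)) \<le> Q" if "norm w = rho" for w
    using that by auto
  have Q0: "Q \<ge> 0"
    using Q[of "of_real rho"] rho r norm_ge_zero order_trans by (metis abs_of_pos less_trans norm_of_real)
  define E where "E = (rho + norm L) * exp (M * (rho + norm L))"
  have E0: "E \<ge> 0"
    using rho r by (auto simp: E_def)
  define B where "B = Q * max 1 E"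
  have B: "Q \<le> B" "Q * E \<le> B" "B \<ge> 0"
    using mult_left_mono[OF max.cobounded1 Q0, of 1 E] mult_left_mono[OF max.cobounded2 Q0, of E 1] Q0
    by (auto simp: B_def)
  have scale: "norm ((-1) ^ (n - 1) * L ^ n * u) \<le> c * (norm L / rho) ^ n"
    if "norm u \<le> c / rho ^ n" for n u c
    using mult_left_mono[OF that, of "norm L ^ n"]
    by (simp add: norm_mult norm_power power_divide mult_ac)
  have bound0: "norm (remainder lam S n 0) \<le> B * (norm L / rho) ^ n" if n: "n \<ge> 1" for n
  proof -
    have "norm (fps_nth (fps_X * 1 / G) n + (\<Sum>k\<in>S. 1 / pole lam k ^ n)) \<le> B / rho ^ n"
      unfolding G_def
    proof (rule coefficient_pole_bound[OF lam, where R = R and h = "\<lambda>_. 1"])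
      fix w :: complex assume "norm w = rho"
      thus "norm (w * 1 / (lam * exp w - 1)) \<le> B"
        using Q[of w] B by simp
    qed (use rho r S B in auto)
    from scale[OF this] show ?thesis
      using remainder_eq[OF lam n, of S 0] by (simp add: G_def L_def)
  qed
  have bound1: "norm (remainder lam S n z - remainder lam S n 0) \<le> B * norm z * (norm L / rho) ^ n"
    if n: "n \<ge> 1" and z: "norm z \<le> M" for n z
  proof -
    define H where "H = fps_const (exp (z * L)) * fps_exp z - 1"
    have *: "norm (fps_nth (fps_X * H / G) n
        + (\<Sum>k\<in>S. (exp (z * (pole lam k + L)) - 1) / pole lam k ^ n)) \<le> B * norm z / rho ^ n"
      unfolding G_def
    proof (rule coefficient_pole_bound[OF lam, where R = R and h = "\<lambda>w. exp (z * (w + L)) - 1"])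
      have "(\<lambda>w. exp (z * L) * exp (z * w) - 1) has_fps_expansion H"
        unfolding H_def by (intro fps_expansion_intros)
      thus "(\<lambda>w. exp (z * (w + L)) - 1) has_fps_expansion H"
        by (simp add: distrib_left exp_add mult_ac)
      show "(\<lambda>w. exp (z * (w + L)) - 1) holomorphic_on UNIV"
        by (intro holomorphic_intros)
      fix w :: complex assume w: "norm w = rho"
      define x where "x = norm (z * (w + L))"
      have "norm (w + L) \<le> rho + norm L"
        using w norm_triangle_ineq[of w L] by simp
      hence x: "x \<le> norm z * (rho + norm L)"
        by (auto simp: x_def norm_mult intro: mult_left_mono)
      also have "\<dots> \<le> M * (rho + norm L)"
        using z rho r by (intro mult_right_mono) auto
      finally have "exp x \<le> exp (M * (rho + norm L))" by simp
      hence "x * exp x \<le> (norm z * (rho + norm L)) * exp (M * (rho + norm L))"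
        using x rho r by (intro mult_mono) (auto simp: x_def)
      hence "norm (exp (z * (w + L)) - 1) \<le> norm z * E"
        using norm_exp_minus_one_le[of "z * (w + L)"] exp_minus_one_le[of x]
        by (simp add: E_def x_def)
      hence "norm (w / (lam * exp w - 1)) * norm (exp (z * (w + L)) - 1) \<le> Q * (norm z * E)"
        using Q[OF w] Q0 by (intro mult_mono) auto
      also have "\<dots> \<le> B * norm z"
        using mult_right_mono[OF B(2), of "norm z"] by (simp add: mult_ac)
      finally show "norm (w * (exp (z * (w + L)) - 1) / (lam * exp w - 1)) \<le> B * norm z"
        by (simp add: norm_mult norm_divide)
    qed (use rho r S B in auto)
    have "fps_X * (fps_const (exp (z * L)) * fps_exp z) / G - fps_X / G = fps_X * H / G"
      by (simp add: fps_divide_unit[OF G0] H_def algebra_simps)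
    hence "fps_nth (fps_X * (fps_const (exp (z * L)) * fps_exp z) / G) n - fps_nth (fps_X / G) n
        = fps_nth (fps_X * H / G) n"
      by (metis fps_sub_nth)
    moreover have "(\<Sum>k\<in>S. (exp (z * (pole lam k + L)) - 1) / pole lam k ^ n)
        = (\<Sum>k\<in>S. exp (z * (pole lam k + L)) / pole lam k ^ n) - (\<Sum>k\<in>S. 1 / pole lam k ^ n)"
      by (simp add: sum_subtractf diff_divide_distrib)
    moreover have "remainder lam S n z = (-1) ^ (n - 1) * L ^ n *
        (fps_nth (fps_X * (fps_const (exp (z * L)) * fps_exp z) / G) n
          + (\<Sum>k\<in>S. exp (z * (pole lam k + L)) / pole lam k ^ n))"
      using remainder_eq[OF lam n, of S z] by (simp only: G_def L_def)
    moreover have "remainder lam S n 0 = (-1) ^ (n - 1) * L ^ n *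
        (fps_nth (fps_X / G) n + (\<Sum>k\<in>S. 1 / pole lam k ^ n))"
      using remainder_eq[OF lam n, of S 0] by (simp add: G_def L_def)
    ultimately have "remainder lam S n z - remainder lam S n 0 = (-1) ^ (n - 1) * L ^ n *
        (fps_nth (fps_X * H / G) n + (\<Sum>k\<in>S. (exp (z * (pole lam k + L)) - 1) / pole lam k ^ n))"
      by (simp add: right_diff_distrib[symmetric] del: minus_one_power_iff)
    thus ?thesis
      using scale[OF *] by simp
  qed
  show ?thesis
    by (intro exI[of _ rho] exI[of _ B] conjI allI impI rho(1) B(3)
        bound0[unfolded S_def L_def] bound1[unfolded S_def L_def])
qed

section \<open>The contribution of the nearest excluded poles\<close>

text \<open>
  Let \<open>I\<close> index the poles in an open disc and \<open>J\<close> those on its boundary circle. After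
  scaling by the \<open>n\<close>-th power of \<open>D = norm (ratio lam k0)\<close>, the terms with index in \<open>J\<close> keep
  modulus of order 1, and everything farther out decays geometrically. The sum of
  \<open>exp (2 \<pi> \<bar>k\<bar> * norm z) - 1\<close> bounds how much the terms from \<open>J\<close> can move when 0 is replaced
  by \<open>z\<close>.
\<close>
lemma nearest_excluded_poles:
  assumes lam: "lam \<noteq> 0" "lam \<noteq> 1" and M: "0 \<le> M"
    and I: "I = {k. norm (pole lam k) < norm (pole lam k0)}"
    and J: "J = {k. norm (pole lam k) = norm (pole lam k0)}"
  shows "\<exists>B\<ge>0. \<exists>q. 0 \<le> q \<and> q < 1 \<and> (\<forall>n\<ge>1.
     norm (ratio lam k0) ^ n * norm (remainder lam I n 0 - (\<Sum>k\<in>J. 1 / ratio lam k ^ n)) \<le> B * q ^ n \<and>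
     (\<forall>z. norm z \<le> M \<longrightarrow>
        norm (ratio lam k0) ^ n * norm (remainder lam I n z - remainder lam I n 0)
          \<le> (\<Sum>k\<in>J. exp (2 * pi * \<bar>real_of_int k\<bar> * norm z) - 1) + B * norm z * q ^ n))"
proof -
  define D where "D = norm (ratio lam k0)"
  define r where "r = norm (pole lam k0)"
  have r0: "r > 0"
    using pole_nonzero[OF lam] by (simp add: r_def)
  have rD: "r = norm (Ln lam) * D"
    by (simp add: r_def D_def pole_eq_ratio[OF lam] norm_mult)
  have D0: "D > 0"
    using r0 rD by (metis D_def mult_zero_right norm_ge_zero order_le_imp_less_or_eq)
  have normJ: "norm (ratio lam k) = D" if "k \<in> J" for k
    using that Ln_nonzero[OF lam] by (simp add: J D_def pole_eq_ratio[OF lam] norm_mult)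
  have fin: "finite I" "finite J"
    by (rule finite_subset[OF _ finite_poles_cball[of lam r]]; auto simp: I J r_def)+
  have IJ: "I \<union> J = {k. norm (pole lam k) \<le> r}" "I \<inter> J = {}"
    by (auto simp: I J r_def)
  \<comment> \<open>The estimate with geometric decay is the one for the closed disc, indexed by \<open>I \<union> J\<close>.\<close>
  obtain rho B where rho: "rho > r" "B \<ge> 0" and
    b0: "\<And>n. n \<ge> 1 \<Longrightarrow> norm (remainder lam (I \<union> J) n 0) \<le> B * (norm (Ln lam) / rho) ^ n" and
    b1: "\<And>n z. n \<ge> 1 \<Longrightarrow> norm z \<le> M \<Longrightarrow>
       norm (remainder lam (I \<union> J) n z - remainder lam (I \<union> J) n 0) \<le> B * norm z * (norm (Ln lam) / rho) ^ n"
    using remainder_bounds[OF lam r0 M] unfolding IJ(1)[symmetric] by metis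
  have split: "remainder lam I n z = remainder lam (I \<union> J) n z
      + (\<Sum>k\<in>J. exp (2 * of_real pi * \<i> * of_int k * z) / ratio lam k ^ n)" for n z
    by (simp add: remainder_def sum.union_disjoint[OF fin IJ(2)] ratio_def)
  define q where "q = r / rho"
  have q: "0 \<le> q" "q < 1"
    using r0 rho by (auto simp: q_def)
  have Dq: "D ^ n * (norm (Ln lam) / rho) ^ n = q ^ n" for n
    by (simp add: q_def rD mult_ac flip: power_mult_distrib)
  have "D ^ n * norm (remainder lam I n 0 - (\<Sum>k\<in>J. 1 / ratio lam k ^ n)) \<le> B * q ^ n"
    if n: "n \<ge> 1" for n
  proof -
    have "D ^ n * norm (remainder lam (I \<union> J) n 0) \<le> D ^ n * (B * (norm (Ln lam) / rho) ^ n)"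
      using b0[OF n] D0 by (intro mult_left_mono) auto
    thus ?thesis
      using Dq[of n] by (simp add: split mult_ac)
  qed
  moreover have "D ^ n * norm (remainder lam I n z - remainder lam I n 0)
      \<le> (\<Sum>k\<in>J. exp (2 * pi * \<bar>real_of_int k\<bar> * norm z) - 1) + B * norm z * q ^ n"
    if n: "n \<ge> 1" and z: "norm z \<le> M" for n z
  proof -
    define u where "u k = (exp (2 * of_real pi * \<i> * of_int k * z) - 1) / ratio lam k ^ n" for k
    define d where "d = remainder lam (I \<union> J) n z - remainder lam (I \<union> J) n 0"
    have "remainder lam I n z - remainder lam I n 0 = d + (\<Sum>k\<in>J. u k)"
      by (simp add: split d_def u_def diff_divide_distrib sum_subtractf)
    hence "norm (remainder lam I n z - remainder lam I n 0) \<le> norm d + (\<Sum>k\<in>J. norm (u k))"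
      using norm_triangle_ineq[of d "\<Sum>k\<in>J. u k"] norm_sum[of u J] by simp
    hence "D ^ n * norm (remainder lam I n z - remainder lam I n 0)
        \<le> D ^ n * (norm d + (\<Sum>k\<in>J. norm (u k)))"
      using D0 by (intro mult_left_mono) auto
    also have "\<dots> = D ^ n * norm d + (\<Sum>k\<in>J. D ^ n * norm (u k))"
      by (simp add: distrib_left sum_distrib_left)
    also have "D ^ n * norm d \<le> B * norm z * q ^ n"
      using mult_left_mono[OF b1[OF n z], of "D ^ n"] D0 Dq[of n] by (simp add: d_def mult_ac)
    also have "(\<Sum>k\<in>J. D ^ n * norm (u k)) \<le> (\<Sum>k\<in>J. exp (2 * pi * \<bar>real_of_int k\<bar> * norm z) - 1)"
    proof (rule sum_mono)
      fix k assume k: "k \<in> J"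
      have "D ^ n * norm (u k) = norm (exp (2 * of_real pi * \<i> * of_int k * z) - 1)"
        using normJ[OF k] D0 by (simp add: u_def norm_divide norm_power)
      also have "\<dots> \<le> exp (norm (2 * of_real pi * \<i> * of_int k * z)) - 1"
        by (rule norm_exp_minus_one_le)
      also have "norm (2 * of_real pi * \<i> * of_int k * z) = 2 * pi * \<bar>real_of_int k\<bar> * norm z"
        by (simp add: norm_mult)
      finally show "D ^ n * norm (u k) \<le> exp (2 * pi * \<bar>real_of_int k\<bar> * norm z) - 1" .
    qed
    finally show ?thesis by simp
  qed
  ultimately show ?thesis
    using q rho(2) unfolding D_def[symmetric] by blast
qed

text \<open>
  At \<open>z = 0\<close> the scaled remainder is, up to a null sequence, a sum of \<open>n\<close>-th powers of
  \<open>card J\<close> numbers of modulus 1. These may cancel for many \<open>n\<close>, but by recurrence all powers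
  come back near 1 for arbitrarily large \<open>n\<close>, and then the sum has modulus near \<open>card J\<close>.
\<close>
lemma card_le_constant_at_zero:
  assumes lam: "lam \<noteq> 0" "lam \<noteq> 1"
    and I: "I = {k. norm (pole lam k) < norm (pole lam k0)}"
    and J: "J = {k. norm (pole lam k) = norm (pole lam k0)}"
    and c: "\<And>n. n \<ge> 2 \<Longrightarrow> norm (ratio lam k0) ^ n * norm (remainder lam I n 0) \<le> c"
  shows "real (card J) \<le> c"
proof (rule field_le_epsilon)
  fix e :: real assume e: "e > 0"
  define D where "D = norm (ratio lam k0)"
  have D0: "D > 0"
    using pole_nonzero[OF lam, of k0] by (auto simp: D_def pole_eq_ratio[OF lam])
  have normJ: "norm (ratio lam k) = D" if "k \<in> J" for k
    using that Ln_nonzero[OF lam] by (simp add: J D_def pole_eq_ratio[OF lam] norm_mult)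
  have finJ: "finite J"
    by (rule finite_subset[OF _ finite_poles_cball[of lam "norm (pole lam k0)"]]) (auto simp: J)
  have cardJ: "card J > 0"
    using finJ by (auto simp: card_gt_0_iff J)
  obtain B q where Bq: "B \<ge> 0" "0 \<le> q" "q < 1" and
    b: "\<And>n. n \<ge> 1 \<Longrightarrow> D ^ n * norm (remainder lam I n 0 - (\<Sum>k\<in>J. 1 / ratio lam k ^ n)) \<le> B * q ^ n"
    using nearest_excluded_poles[OF lam order.refl I J] unfolding D_def[symmetric] by metis
  have "(\<lambda>n. B * q ^ n) \<longlonglongrightarrow> B * 0"
    using Bq by (intro tendsto_mult tendsto_const LIMSEQ_power_zero) auto
  hence "\<forall>\<^sub>F n in sequentially. B * q ^ n < e / 2"
    using e by (intro order_tendstoD) auto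
  then obtain N where N: "\<And>n. n \<ge> N \<Longrightarrow> B * q ^ n < e / 2"
    unfolding eventually_sequentially by blast
  define v where "v k = of_real D / ratio lam k" for k
  have v: "norm (v k) = 1" if "k \<in> J" for k
    using normJ[OF that] D0 by (simp add: v_def norm_divide)
  obtain n where n: "n \<ge> max N 2" "\<And>k. k \<in> J \<Longrightarrow> norm (v k ^ n - 1) < e / (2 * card J)"
    using unit_powers_recur[of J v "e / (2 * card J)" "max N 2"] finJ v e cardJ by auto
  have "norm (\<Sum>k\<in>J. v k ^ n - 1) \<le> (\<Sum>k\<in>J. e / (2 * card J))"
    by (rule sum_norm_le) (use n(2) in \<open>auto intro: less_imp_le\<close>)
  hence 1: "norm ((\<Sum>k\<in>J. v k ^ n) - of_nat (card J)) \<le> e / 2"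
    using cardJ by (simp add: sum_subtractf)
  have "D ^ n * norm (\<Sum>k\<in>J. 1 / ratio lam k ^ n) = norm (of_real D ^ n * (\<Sum>k\<in>J. 1 / ratio lam k ^ n))"
    using D0 by (simp add: norm_mult norm_power)
  also have "of_real D ^ n * (\<Sum>k\<in>J. 1 / ratio lam k ^ n) = (\<Sum>k\<in>J. v k ^ n)"
    by (simp add: sum_distrib_left v_def power_divide)
  finally have 2: "D ^ n * norm (\<Sum>k\<in>J. 1 / ratio lam k ^ n) = norm (\<Sum>k\<in>J. v k ^ n)" .
  have "norm (\<Sum>k\<in>J. 1 / ratio lam k ^ n) \<le> norm (remainder lam I n 0)
      + norm (remainder lam I n 0 - (\<Sum>k\<in>J. 1 / ratio lam k ^ n))"
    by norm
  hence "D ^ n * norm (\<Sum>k\<in>J. 1 / ratio lam k ^ n) \<le> D ^ n * (norm (remainder lam I n 0)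
      + norm (remainder lam I n 0 - (\<Sum>k\<in>J. 1 / ratio lam k ^ n)))"
    using D0 by (intro mult_left_mono) auto
  also have "\<dots> \<le> c + e / 2"
    using c[of n] b[of n] N[of n] n(1) by (simp add: D_def distrib_left)
  finally have "norm (\<Sum>k\<in>J. v k ^ n) \<le> c + e / 2"
    by (simp add: 2)
  moreover have "real (card J) \<le> norm (\<Sum>k\<in>J. v k ^ n) + norm ((\<Sum>k\<in>J. v k ^ n) - of_nat (card J))"
    using norm_triangle_sub[of "of_nat (card J)" "\<Sum>k\<in>J. v k ^ n"]
    by (simp add: norm_minus_commute)
  ultimately show "real (card J) \<le> c + e"
    using 1 by simp
qed

text \<open>
  A single rate that stays below \<open>A\<close> by \<open>d\<close> leaves room for a linear error term \<open>d * t\<close>.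
\<close>
lemma growth_deficit:
  fixes a :: "'a \<Rightarrow> real"
  assumes J: "finite J" "k0 \<in> J" and a: "\<And>k. k \<in> J \<Longrightarrow> a k \<le> A"
    and k0: "a k0 + d \<le> A" "a k0 \<ge> 0" and d: "d \<ge> 0" and t: "t \<ge> 0"
  shows "(\<Sum>k\<in>J. exp (a k * t) - 1) + d * t \<le> card J * (exp (A * t) - 1)"
proof -
  have "exp (a k0 * t) + d * t \<le> exp (a k0 * t) + exp (a k0 * t) * (d * t)"
    using mult_right_mono[of 1 "exp (a k0 * t)" "d * t"] k0 d t by simp
  also have "\<dots> = exp (a k0 * t) * (1 + d * t)"
    by (simp add: algebra_simps)
  also have "\<dots> \<le> exp (a k0 * t) * exp (d * t)"
    using exp_ge_add_one_self[of "d * t"] by (intro mult_left_mono) auto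
  also have "\<dots> = exp ((a k0 + d) * t)"
    by (simp add: exp_add algebra_simps)
  also have "\<dots> \<le> exp (A * t)"
    using k0 t by (simp add: mult_right_mono)
  finally have 1: "exp (a k0 * t) - 1 + d * t \<le> exp (A * t) - 1" by simp
  have 2: "(\<Sum>k\<in>J - {k0}. exp (a k * t) - 1) \<le> (\<Sum>k\<in>J - {k0}. exp (A * t) - 1)"
    using a t by (intro sum_mono) (auto intro: mult_right_mono)
  have "(\<Sum>k\<in>J. exp (a k * t) - 1) + d * t
      = (exp (a k0 * t) - 1 + d * t) + (\<Sum>k\<in>J - {k0}. exp (a k * t) - 1)"
    using sum.remove[OF J, of "\<lambda>k. exp (a k * t) - 1"] by simp
  also have "\<dots> \<le> (exp (A * t) - 1) + (\<Sum>k\<in>J - {k0}. exp (A * t) - 1)"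
    using 1 2 by (rule add_mono)
  also have "\<dots> = (\<Sum>k\<in>J. exp (A * t) - 1)"
    using sum.remove[OF J, of "\<lambda>k. exp (A * t) - 1"] by simp
  finally show ?thesis by simp
qed

section \<open>Admissible windows consist of the poles in an open disc\<close>

text \<open>
  The poles lie on a vertical line with spacing \<open>2 \<pi>\<close>, so comparing their moduli is comparing
  the distances of integers to one real number, which for the principal logarithm lies in
  \<open>(-1/2, 1/2]\<close>.
\<close>
lemma norm_pole_less_iff:
  fixes lam :: complex
  defines "t \<equiv> Im (Ln lam) / (2 * pi)"
  shows "norm (pole lam k) < norm (pole lam j) \<longleftrightarrow> \<bar>real_of_int k - t\<bar> < \<bar>real_of_int j - t\<bar>"
proof -
  have sq: "\<bar>x\<bar> < \<bar>y\<bar> \<longleftrightarrow> x\<^sup>2 < y\<^sup>2" for x y :: real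
    by (meson abs_le_square_iff not_le)
  have "(norm (pole lam k))\<^sup>2 = (Re (Ln lam))\<^sup>2 + (2 * pi)\<^sup>2 * (real_of_int k - t)\<^sup>2" for k
  proof -
    have "2 * pi * real_of_int k - Im (Ln lam) = 2 * pi * (real_of_int k - t)"
      by (simp add: t_def field_simps)
    thus ?thesis
      by (simp add: cmod_power2 pole_def power_mult_distrib)
  qed
  hence "(norm (pole lam k))\<^sup>2 < (norm (pole lam j))\<^sup>2 \<longleftrightarrow> (real_of_int k - t)\<^sup>2 < (real_of_int j - t)\<^sup>2"
    by simp
  thus ?thesis
    using sq[of "norm (pole lam k)" "norm (pole lam j)"] by (simp add: sq)
qed

text \<open>
  The conditions on \<open>lam\<close> locate \<open>t = Im (Ln lam) / (2 * pi)\<close> relative to 0 and 1/2 and thereby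
  decide which of the indices \<open>m + 1\<close> and \<open>- (m + 1)\<close> follows next when the integers are ordered by their
  distance to \<open>t\<close>. For \<open>t = 0\<close> and \<open>t = 1/2\<close> two excluded integers are equally close; this is why
  the index \<open>k0\<close> enters only through the modulus of its pole.
\<close>
lemma admissible_nearest:
  assumes lam: "lam \<noteq> 0" "lam \<noteq> 1" and adm: "admissible lam m I D"
  obtains k0 where "\<bar>k0\<bar> = int m + 1" "I = {k. norm (pole lam k) < norm (pole lam k0)}"
    "D = norm (ratio lam k0)"
proof -
  define t where "t = Im (Ln lam) / (2 * pi)"
  have t: "-1/2 < t" "t \<le> 1/2"
    using mpi_less_Im_Ln[OF lam(1)] Im_Ln_le_pi[OF lam(1)] by (auto simp: t_def field_simps)
  have near: "{k. norm (pole lam k) < norm (pole lam j)} = {k. \<bar>real_of_int k - t\<bar> < \<bar>real_of_int j - t\<bar>}" for j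
    by (simp add: norm_pole_less_iff t_def)
  have minus: "dist_minus lam m = norm (ratio lam (int m + 1))"
    by (simp add: dist_minus_def ratio_def)
  have plus: "dist_plus lam m = norm (ratio lam (- (int m + 1)))"
  proof -
    have "of_int (- (int m + 1)) = - (of_nat m + 1 :: complex)" by simp
    thus ?thesis
      by (simp only: dist_plus_def ratio_def mult_minus_right minus_divide_left[symmetric]
          diff_minus_eq_add)
  qed
  consider (1) "0 \<le> t" "t < 1/2" "I = window m" "D = dist_minus lam m"
    | (2) "0 < t" "I = window_plus m" "D = dist_plus lam m"
    | (3) "t < 0" "I = window m" "D = dist_plus lam m"
    | (4) "t < 0" "I = window_minus m" "D = dist_minus lam m"
  proof -
    have pos: "0 < t \<and> t < 1/2" if "Im lam > 0"
      using Im_Ln_pos_lt[OF lam(1)] that by (auto simp: t_def field_simps)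
    have neg: "t < 0" if "Im lam < 0"
      using Im_Ln_pos_le[OF lam(1)] Im_Ln_le_pi[OF lam(1)] that by (auto simp: t_def field_simps)
    have zero: "t = 0" if "lam \<in> \<real>" "Re lam > 0"
      using Im_Ln_eq_0[OF lam(1)] that by (auto simp: t_def complex_is_Real_iff)
    have half: "t > 0" if "lam \<in> \<real>" "Re lam < 0"
      using Im_Ln_eq_pi[OF lam(1)] that by (auto simp: t_def complex_is_Real_iff)
    show thesis
      using adm unfolding admissible_def Pair_inject
      by (elim disjE conjE) (use pos neg zero half that in force)+
  qed
  thus thesis
  proof cases
    case 1
    have "window m = {k. \<bar>real_of_int k - t\<bar> < \<bar>real_of_int (int m + 1) - t\<bar>}"
      using 1(1,2) by (auto simp: window_def)
    with 1 show thesis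
      by (intro that[of "int m + 1"]) (auto simp: near minus)
  next
    case 2
    have "window_plus m = {k. \<bar>real_of_int k - t\<bar> < \<bar>real_of_int (- (int m + 1)) - t\<bar>}"
      using 2(1) t(2) by (auto simp: window_plus_def window_def)
    with 2 show thesis
      by (intro that[of "- (int m + 1)"]) (auto simp: near plus)
  next
    case 3
    have "window m = {k. \<bar>real_of_int k - t\<bar> < \<bar>real_of_int (- (int m + 1)) - t\<bar>}"
      using 3(1) t(1) by (auto simp: window_def)
    with 3 show thesis
      by (intro that[of "- (int m + 1)"]) (auto simp: near plus)
  next
    case 4
    have "window_minus m = {k. \<bar>real_of_int k - t\<bar> < \<bar>real_of_int (int m + 1) - t\<bar>}"
      using 4(1) t(1) by (auto simp: window_minus_def window_def)
    with 4 show thesis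
      by (intro that[of "int m + 1"]) (auto simp: near minus)
  qed
qed

section \<open>The asymptotic expansion with an explicit error term\<close>

theorem proposition5:
  fixes lam :: complex and m :: nat and K :: "complex set" and I :: "int set" and D :: real
  assumes "lam \<noteq> 0" and "lam \<noteq> 1"
    and "compact K"
    and "admissible lam m I D"
  shows "(\<exists>C. \<forall>n\<ge>2. \<forall>z\<in>K. estimate lam m I D C n z) \<and>
         (\<exists>N. \<forall>c. (\<forall>n\<ge>2. estimate lam m I D c n 0) \<longrightarrow>
                  (\<forall>n\<ge>N. \<forall>z\<in>K. estimate lam m I D c n z))"
proof -
  note lam = assms(1,2)
  define A where "A = 2 * norm (Ln lam) + 2 * pi * (real m + 1)"
  obtain k0 where k0: "\<bar>k0\<bar> = int m + 1" "I = {k. norm (pole lam k) < norm (pole lam k0)}"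
      "D = norm (ratio lam k0)"
    using admissible_nearest[OF lam assms(4)] by metis
  define J where "J = {k. norm (pole lam k) = norm (pole lam k0)}"
  define W where "W z = (\<Sum>k\<in>J. exp (2 * pi * \<bar>real_of_int k\<bar> * norm z) - 1)" for z :: complex
  have D0: "D > 0"
    using admissible_pos[OF assms(1,4)] .
  have estimate_iff: "estimate lam m I D c n z \<longleftrightarrow> D ^ n * norm (remainder lam I n z) \<le> c * exp (A * norm z)"
    for c n z
    using D0 by (simp add: estimate_def A_def field_simps)
  have finJ: "finite J"
    by (rule finite_subset[OF _ finite_poles_cball[of lam "norm (pole lam k0)"]]) (auto simp: J_def)
  have rk0: "\<bar>real_of_int k0\<bar> = real m + 1"
    using k0(1) by linarith
  \<comment> \<open>A pole on the circle through \<open>pole lam k0\<close> has \<open>2 \<pi> \<bar>k\<bar> \<le> norm (pole lam k0) + norm (Ln lam) \<le> A\<close>,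
     and for \<open>k0\<close> itself \<open>2 \<pi> \<bar>k0\<bar>\<close> stays below \<open>A\<close> by the full amount \<open>2 * norm (Ln lam)\<close>.\<close>
  have W: "W z + 2 * norm (Ln lam) * norm z \<le> card J * (exp (A * norm z) - 1)" for z
    unfolding W_def
  proof (rule growth_deficit[OF finJ])
    fix k assume "k \<in> J"
    thus "2 * pi * \<bar>real_of_int k\<bar> \<le> A"
      using norm_frequency_le[of k lam] norm_pole_le[of lam k0] by (simp add: J_def A_def rk0)
  qed (auto simp: J_def A_def rk0)
  obtain M where M: "M \<ge> 0" "\<And>z. z \<in> K \<Longrightarrow> norm z \<le> M"
    using compact_imp_bounded[OF assms(3)] unfolding bounded_pos by (metis less_imp_le)
  obtain B q where B: "B \<ge> 0" and q: "0 \<le> q" "q < 1" and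
    b0: "\<And>n. n \<ge> 1 \<Longrightarrow> D ^ n * norm (remainder lam I n 0 - (\<Sum>k\<in>J. 1 / ratio lam k ^ n)) \<le> B * q ^ n" and
    b1: "\<And>n z. n \<ge> 1 \<Longrightarrow> norm z \<le> M \<Longrightarrow>
        D ^ n * norm (remainder lam I n z - remainder lam I n 0) \<le> W z + B * norm z * q ^ n"
    using nearest_excluded_poles[OF lam M(1) k0(2) J_def] unfolding k0(3)[symmetric] W_def by metis
  have step: "D ^ n * norm (remainder lam I n z)
      \<le> D ^ n * norm (remainder lam I n 0) + W z + B * norm z * q ^ n"
    if n: "n \<ge> 1" and z: "norm z \<le> M" for n z
  proof -
    have "norm (remainder lam I n z)
        \<le> norm (remainder lam I n 0) + norm (remainder lam I n z - remainder lam I n 0)"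
      by norm
    hence "D ^ n * norm (remainder lam I n z)
        \<le> D ^ n * (norm (remainder lam I n 0) + norm (remainder lam I n z - remainder lam I n 0))"
      using D0 by (intro mult_left_mono) auto
    thus ?thesis
      using b1[OF n z] by (simp add: distrib_left)
  qed
  have first: "estimate lam m I D (2 * card J + B + B * M) n z" if n: "n \<ge> 2" and z: "z \<in> K" for n z
  proof -
    have qn: "q ^ n \<le> 1"
      using q by (simp add: power_le_one)
    have e1: "exp (A * norm z) \<ge> 1"
      by (simp add: A_def)
    have "D ^ n * norm (\<Sum>k\<in>J. 1 / ratio lam k ^ n) \<le> D ^ n * (\<Sum>k\<in>J. 1 / D ^ n)"
    proof (intro mult_left_mono sum_norm_le)
      fix k assume "k \<in> J"
      hence "norm (ratio lam k) = D"
        using Ln_nonzero[OF lam] by (simp add: J_def k0(3) pole_eq_ratio[OF lam] norm_mult)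
      thus "norm (1 / ratio lam k ^ n) \<le> 1 / D ^ n"
        by (simp add: norm_divide norm_power)
    qed (use D0 in auto)
    hence s: "D ^ n * norm (\<Sum>k\<in>J. 1 / ratio lam k ^ n) \<le> card J"
      using D0 by simp
    have "norm (remainder lam I n 0) \<le> norm (\<Sum>k\<in>J. 1 / ratio lam k ^ n)
        + norm (remainder lam I n 0 - (\<Sum>k\<in>J. 1 / ratio lam k ^ n))"
      by norm
    hence "D ^ n * norm (remainder lam I n 0) \<le> D ^ n * (norm (\<Sum>k\<in>J. 1 / ratio lam k ^ n)
        + norm (remainder lam I n 0 - (\<Sum>k\<in>J. 1 / ratio lam k ^ n)))"
      using D0 by (intro mult_left_mono) auto
    also have "\<dots> \<le> card J + B * q ^ n"
      using s b0[of n] n by (simp add: distrib_left)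
    also have "\<dots> \<le> card J + B"
      using mult_left_mono[OF qn B] by simp
    finally have "D ^ n * norm (remainder lam I n z) \<le> card J + B + W z + B * norm z * q ^ n"
      using step[of n z] M(2)[OF z] n by simp
    also have "B * norm z * q ^ n \<le> B * M * 1"
      using M z B qn q by (intro mult_mono) auto
    also have "W z \<le> card J * exp (A * norm z)"
    proof -
      have "0 \<le> 2 * norm (Ln lam) * norm z" by simp
      hence "W z \<le> card J * (exp (A * norm z) - 1)"
        using W[of z] by linarith
      also have "\<dots> \<le> card J * exp (A * norm z)"
        by (intro mult_left_mono) auto
      finally show ?thesis .
    qed
    finally have "D ^ n * norm (remainder lam I n z)
        \<le> (card J + B + B * M) * 1 + card J * exp (A * norm z)" by simp
    also have "\<dots> \<le> (card J + B + B * M) * exp (A * norm z) + card J * exp (A * norm z)"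
      using e1 B M(1) by (intro add_mono mult_left_mono) auto
    finally show ?thesis
      unfolding estimate_iff by (simp add: algebra_simps)
  qed
  \<comment> \<open>\<open>N\<close> is chosen so that the geometric error fits into the room \<open>2 * norm (Ln lam) * norm z\<close>
     left by the term for \<open>k0\<close>; the choice depends on \<open>K\<close> through \<open>B\<close>, but not on \<open>c\<close>.\<close>
  have "(\<lambda>n. B * q ^ n) \<longlonglongrightarrow> B * 0"
    using q by (intro tendsto_mult tendsto_const LIMSEQ_power_zero) auto
  hence "\<forall>\<^sub>F n in sequentially. B * q ^ n < 2 * norm (Ln lam)"
    using Ln_nonzero[OF lam] by (intro order_tendstoD) auto
  then obtain N where N: "\<And>n. n \<ge> N \<Longrightarrow> B * q ^ n < 2 * norm (Ln lam)"
    unfolding eventually_sequentially by blast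
  have second: "estimate lam m I D c n z"
    if c: "\<forall>n\<ge>2. estimate lam m I D c n 0" and n: "n \<ge> max N 2" and z: "z \<in> K" for c n z
  proof -
    have c0: "D ^ n * norm (remainder lam I n 0) \<le> c" if "n \<ge> 2" for n
      using c that unfolding estimate_iff by simp
    have cJ: "card J \<le> c"
      by (rule card_le_constant_at_zero[OF lam k0(2) J_def c0[unfolded k0(3)]])
    have "D ^ n * norm (remainder lam I n z)
        \<le> D ^ n * norm (remainder lam I n 0) + W z + B * norm z * q ^ n"
      using step[of n z] n M(2)[OF z] by simp
    also have "\<dots> \<le> c + W z + 2 * norm (Ln lam) * norm z"
      using c0[of n] N[of n] n mult_right_mono[of "B * q ^ n" "2 * norm (Ln lam)" "norm z"]
      by (simp add: mult_ac)
    also have "\<dots> \<le> c + card J * (exp (A * norm z) - 1)"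
      using W[of z] by simp
    also have "\<dots> \<le> c + c * (exp (A * norm z) - 1)"
      using cJ by (intro add_left_mono mult_right_mono) (auto simp: A_def)
    finally show ?thesis
      unfolding estimate_iff by (simp add: algebra_simps)
  qed
  show ?thesis
    using first second by blast
qed

end
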